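(* For every $d\ge1$, the set of entanglement-breaking trace-preserving (EBT) maps on $M_d(\mathbb{C})$ is convex.
   Context: $M_d(\mathbb{C})$ is the algebra of complex $d\times d$ matrices. A CPT (stochastic) map is a linear map $\Phi:M_d(\mathbb{C})\to M_d(\mathbb{C})$ that is completely positive and trace-preserving. A density matrix (positive semi-definite, trace one) on a tensor product of two finite-dimensional Hilbert spaces is separable if it is a convex combination of tensor products of density matrices. A CPT map $\Phi$ is EBT (entanglement breaking and trace-preserving) if $(I\otimes\Phi)(\Gamma)$ is separable for every density matrix $\Gamma$ on $\mathbb{C}^n\otimes\mathbb{C}^d$ and every $n\ge1$ (here $I$ is the identity map on $M_n(\mathbb{C})$). *)

theory Defs
  imports "Jordan_Normal_Form.VS_Connect"
begin

definition mat_trace :: "complex mat \<Rightarrow> complex" where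
  "mat_trace A = (\<Sum>i<dim_row A. A $$ (i, i))"

text \<open>In the order on \<^typ>\<open>complex\<close> used here, \<open>0 \<le> z\<close> means that \<open>z\<close> is real and nonnegative;
  the matrix \<open>A\<close> below is therefore automatically Hermitian.\<close>

definition pos_semidef :: "nat \<Rightarrow> complex mat \<Rightarrow> bool" where
  "pos_semidef n A \<longleftrightarrow>
     A \<in> carrier_mat n n \<and> (\<forall>v\<in>carrier_vec n. 0 \<le> (A *\<^sub>v v) \<bullet>c v)"

definition density :: "nat \<Rightarrow> complex mat \<Rightarrow> bool" where
  "density n A \<longleftrightarrow> pos_semidef n A \<and> mat_trace A = 1"

text \<open>The Kronecker product. The basis vector \<open>e\<^sub>i \<otimes> e\<^sub>k\<close> of the tensor product of
  spaces of dimensions \<open>n\<close> and \<open>d\<close> has index \<open>i * d + k\<close>.\<close>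

definition tensor_mat :: "complex mat \<Rightarrow> complex mat \<Rightarrow> complex mat" where
  "tensor_mat A B =
     mat (dim_row A * dim_row B) (dim_col A * dim_col B)
       (\<lambda>(r, c). A $$ (r div dim_row B, c div dim_col B) *
                 B $$ (r mod dim_row B, c mod dim_col B))"

definition separable :: "nat \<Rightarrow> nat \<Rightarrow> complex mat \<Rightarrow> bool" where
  "separable n d \<Gamma> \<longleftrightarrow>
     (\<exists>(m::nat) (p :: nat \<Rightarrow> real) \<rho> \<sigma>.
        (\<forall>k<m. 0 \<le> p k \<and> density n (\<rho> k) \<and> density d (\<sigma> k)) \<and>
        (\<Sum>k<m. p k) = 1 \<and>
        \<Gamma> = finsum (module_mat TYPE(complex) (n * d) (n * d))
              (\<lambda>k. complex_of_real (p k) \<cdot>\<^sub>m tensor_mat (\<rho> k) (\<sigma> k)) {..<m})"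

text \<open>A map on the \<open>d \<times> d\<close> matrices is represented by the HOL function that is
  \<^const>\<open>undefined\<close> off the carrier, so that each map has exactly one representative.\<close>

definition linear_maps :: "nat \<Rightarrow> (complex mat \<Rightarrow> complex mat) set" where
  "linear_maps d =
     LinearCombinations.module_hom class_ring
       (module_mat TYPE(complex) d d) (module_mat TYPE(complex) d d)
       \<inter> extensional (carrier_mat d d)"

text \<open>\<open>mat_block d \<Gamma> i j\<close> is the \<open>d \<times> d\<close> block of \<open>\<Gamma>\<close> in block row \<open>i\<close> and block column \<open>j\<close>.
  The map \<open>I \<otimes> \<Phi>\<close> sends \<open>\<Gamma> = \<Sum>\<^sub>i\<^sub>j E\<^sub>i\<^sub>j \<otimes> \<Gamma>\<^sub>i\<^sub>j\<close> to \<open>\<Sum>\<^sub>i\<^sub>j E\<^sub>i\<^sub>j \<otimes> \<Phi> \<Gamma>\<^sub>i\<^sub>j\<close>,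
  that is, it applies \<open>\<Phi>\<close> to every block. The lemmas after the definition show that, for linear
  \<open>\<Phi>\<close>, this is the linear map taking \<open>A \<otimes> B\<close> to \<open>A \<otimes> \<Phi> B\<close>.\<close>

definition mat_block :: "nat \<Rightarrow> complex mat \<Rightarrow> nat \<Rightarrow> nat \<Rightarrow> complex mat" where
  "mat_block d \<Gamma> i j = mat d d (\<lambda>(k, l). \<Gamma> $$ (i * d + k, j * d + l))"

definition id_tensor ::
  "nat \<Rightarrow> nat \<Rightarrow> (complex mat \<Rightarrow> complex mat) \<Rightarrow> complex mat \<Rightarrow> complex mat" where
  "id_tensor n d \<Phi> \<Gamma> =
     mat (n * d) (n * d)
       (\<lambda>(r, c). \<Phi> (mat_block d \<Gamma> (r div d) (c div d)) $$ (r mod d, c mod d))"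

lemma linear_mapsD:
  assumes "\<Phi> \<in> linear_maps d"
  shows "X \<in> carrier_mat d d \<Longrightarrow> \<Phi> X \<in> carrier_mat d d"
    and "X \<in> carrier_mat d d \<Longrightarrow> Y \<in> carrier_mat d d \<Longrightarrow> \<Phi> (X + Y) = \<Phi> X + \<Phi> Y"
    and "X \<in> carrier_mat d d \<Longrightarrow> \<Phi> (a \<cdot>\<^sub>m X) = a \<cdot>\<^sub>m \<Phi> X"
  using assms
  by (auto simp: linear_maps_def LinearCombinations.module_hom_def module_mat_simps class_ring_simps)

lemma block_index_less:
  fixes i k :: nat
  assumes "i < n" "k < d"
  shows "i * d + k < n * d"
proof -
  have "i * d + k < Suc i * d" using assms by simp
  also have "\<dots> \<le> n * d" using assms by (intro mult_right_mono) auto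
  finally show ?thesis .
qed

lemma div_less_block: "r < n * d \<Longrightarrow> r div d < n" for r n d :: nat
  by (simp add: less_mult_imp_div_less)

lemma mod_less_block: "r < n * d \<Longrightarrow> r mod d < d" for r n d :: nat
  by (cases "d = 0") auto

lemma mat_block_carrier [simp]: "mat_block d \<Gamma> i j \<in> carrier_mat d d"
  by (simp add: mat_block_def)

lemma id_tensor_linear:
  assumes "\<Phi> \<in> linear_maps d"
  shows "id_tensor n d \<Phi> \<in>
    LinearCombinations.module_hom class_ring (module_mat TYPE(complex) (n * d) (n * d))
      (module_mat TYPE(complex) (n * d) (n * d))"
proof -
  have blk_add: "mat_block d (A + B) i j = mat_block d A i j + mat_block d B i j"
    if "A \<in> carrier_mat (n * d) (n * d)" "B \<in> carrier_mat (n * d) (n * d)" "i < n" "j < n"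
    for A B i j
    using that by (intro eq_matI) (auto simp: mat_block_def block_index_less)
  have blk_smult: "mat_block d (a \<cdot>\<^sub>m A) i j = a \<cdot>\<^sub>m mat_block d A i j"
    if "A \<in> carrier_mat (n * d) (n * d)" "i < n" "j < n" for a A i j
    using that by (intro eq_matI) (auto simp: mat_block_def block_index_less)
  note L = linear_mapsD[OF assms]
  have C: "dim_row (\<Phi> (mat_block d A i j)) = d" "dim_col (\<Phi> (mat_block d A i j)) = d" for A i j
    using L(1)[OF mat_block_carrier[of d A i j]] by auto
  have add: "id_tensor n d \<Phi> (A + B) = id_tensor n d \<Phi> A + id_tensor n d \<Phi> B"
    if "A \<in> carrier_mat (n * d) (n * d)" "B \<in> carrier_mat (n * d) (n * d)" for A B
    using that
    by (intro eq_matI)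
      (auto simp: id_tensor_def blk_add L(2) C div_less_block mod_less_block)
  have smult: "id_tensor n d \<Phi> (a \<cdot>\<^sub>m A) = a \<cdot>\<^sub>m id_tensor n d \<Phi> A"
    if "A \<in> carrier_mat (n * d) (n * d)" for a A
    using that
    by (intro eq_matI)
      (auto simp: id_tensor_def blk_smult L(3) C div_less_block mod_less_block)
  show ?thesis
    using add smult
    by (auto simp: LinearCombinations.module_hom_def module_mat_simps class_ring_simps id_tensor_def)
qed

lemma id_tensor_tensor_mat:
  assumes "\<Phi> \<in> linear_maps d" "A \<in> carrier_mat n n" "B \<in> carrier_mat d d"
  shows "id_tensor n d \<Phi> (tensor_mat A B) = tensor_mat A (\<Phi> B)"
proof -
  note L = linear_mapsD[OF assms(1)]
  have blk: "mat_block d (tensor_mat A B) i j = A $$ (i, j) \<cdot>\<^sub>m B" if "i < n" "j < n" for i j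
    using that assms(2,3)
    by (intro eq_matI) (auto simp: mat_block_def tensor_mat_def block_index_less)
  show ?thesis
    using assms(2,3) L(1)[OF assms(3)]
    by (intro eq_matI)
      (auto simp: id_tensor_def blk L(3) tensor_mat_def[of A "\<Phi> B"]
        div_less_block mod_less_block)
qed

definition completely_positive :: "nat \<Rightarrow> (complex mat \<Rightarrow> complex mat) \<Rightarrow> bool" where
  "completely_positive d \<Phi> \<longleftrightarrow>
     (\<forall>n\<ge>1. \<forall>A. pos_semidef (n * d) A \<longrightarrow> pos_semidef (n * d) (id_tensor n d \<Phi> A))"

definition trace_preserving :: "nat \<Rightarrow> (complex mat \<Rightarrow> complex mat) \<Rightarrow> bool" where
  "trace_preserving d \<Phi> \<longleftrightarrow> (\<forall>X\<in>carrier_mat d d. mat_trace (\<Phi> X) = mat_trace X)"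

definition CPT :: "nat \<Rightarrow> (complex mat \<Rightarrow> complex mat) set" where
  "CPT d = {\<Phi> \<in> linear_maps d. completely_positive d \<Phi> \<and> trace_preserving d \<Phi>}"

definition EBT :: "nat \<Rightarrow> (complex mat \<Rightarrow> complex mat) set" where
  "EBT d = {\<Phi> \<in> CPT d.
     \<forall>n\<ge>1. \<forall>\<Gamma>. density (n * d) \<Gamma> \<longrightarrow> separable n d (id_tensor n d \<Phi> \<Gamma>)}"

text \<open>This is \<open>convex\<close> from \<open>HOL-Analysis\<close>, written out for the pointwise vector space structure
  on the maps of \<^const>\<open>linear_maps\<close>: \<^typ>\<open>complex mat \<Rightarrow> complex mat\<close> is not an instance of
  \<^class>\<open>real_vector\<close>, because matrices of all sizes share one type.\<close>

definition convex_maps :: "nat \<Rightarrow> (complex mat \<Rightarrow> complex mat) set \<Rightarrow> bool" where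
  "convex_maps d S \<longleftrightarrow>
     (\<forall>\<Phi>\<in>S. \<forall>\<Psi>\<in>S. \<forall>u\<ge>0. \<forall>v\<ge>0. u + v = 1 \<longrightarrow>
        (\<lambda>X\<in>carrier_mat d d.
           complex_of_real u \<cdot>\<^sub>m \<Phi> X + complex_of_real v \<cdot>\<^sub>m \<Psi> X) \<in> S)"

end

theory Submission
  imports Defs
begin

text \<open>Every condition defining an EBT map survives convex combination because \<Phi> enters it
  linearly. The key identity is \<open>id_tensor_mix_map\<close>: (I \<otimes> (u\<Phi> +
  v\<Psi>))(A) = u (I \<otimes> \<Phi>)(A) + v (I \<otimes> \<Psi>)(A). Hence everything reduces to
  convexity of the sets of possible outputs. Positive semidefinite matrices form a convex cone
  (\<open>pos_semidef_combination\<close>), which gives complete positivity; linearity of the trace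
  and u + v = 1 give trace preservation; and separable matrices form a convex set
  (\<open>separable_combination\<close>), since two convex combinations of product states merge into
  one. The last fact, applied to each density matrix on the input side, is entanglement
  breaking.\<close>

text \<open>The restricted lambda takes the value \<open>undefined\<close> off the carrier, so the
  combination is again the canonical representative that \<open>linear_maps\<close> asks
  for.\<close>

definition mix_map ::
  "nat \<Rightarrow> real \<Rightarrow> real \<Rightarrow> (complex mat \<Rightarrow> complex mat) \<Rightarrow> (complex mat \<Rightarrow> complex mat) \<Rightarrow>
    complex mat \<Rightarrow> complex mat" where
  "mix_map d u v \<Phi> \<Psi> = (\<lambda>X\<in>carrier_mat d d.
     complex_of_real u \<cdot>\<^sub>m \<Phi> X + complex_of_real v \<cdot>\<^sub>m \<Psi> X)"

lemma mix_map_linear: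
  assumes "\<Phi> \<in> linear_maps d" "\<Psi> \<in> linear_maps d"
  shows "mix_map d u v \<Phi> \<Psi> \<in> linear_maps d"
proof -
  note L = linear_mapsD[OF assms(1)] linear_mapsD[OF assms(2)]
  have add: "mix_map d u v \<Phi> \<Psi> (X + Y) = mix_map d u v \<Phi> \<Psi> X + mix_map d u v \<Phi> \<Psi> Y"
    if "X \<in> carrier_mat d d" "Y \<in> carrier_mat d d" for X Y
    using that L(1)[OF that(1)] L(1)[OF that(2)] L(4)[OF that(1)] L(4)[OF that(2)]
    by (intro eq_matI) (auto simp: mix_map_def L(2,5) algebra_simps)
  have smult: "mix_map d u v \<Phi> \<Psi> (a \<cdot>\<^sub>m X) = a \<cdot>\<^sub>m mix_map d u v \<Phi> \<Psi> X"
    if "X \<in> carrier_mat d d" for a X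
    using that L(1)[OF that] L(4)[OF that]
    by (intro eq_matI) (auto simp: mix_map_def L(3,6) algebra_simps)
  have carr: "mix_map d u v \<Phi> \<Psi> X \<in> carrier_mat d d" if "X \<in> carrier_mat d d" for X
    using that L(1)[OF that] L(4)[OF that] by (auto simp: mix_map_def)
  have "mix_map d u v \<Phi> \<Psi> \<in> extensional (carrier_mat d d)"
    by (simp add: mix_map_def)
  then show ?thesis
    using add smult carr
    by (auto simp: linear_maps_def LinearCombinations.module_hom_def module_mat_simps class_ring_simps)
qed

lemma id_tensor_carrier: "id_tensor n d \<Phi> A \<in> carrier_mat (n * d) (n * d)"
  by (simp add: id_tensor_def)

text \<open>\<open>id_tensor\<close> acts block by block, and each block is d by d by construction
  of \<open>mat_block\<close>, so the pointwise combination can be evaluated on it for an arbitrary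
  A.\<close>

lemma id_tensor_mix_map:
  assumes "\<Phi> \<in> linear_maps d" "\<Psi> \<in> linear_maps d"
  shows "id_tensor n d (mix_map d u v \<Phi> \<Psi>) A =
    complex_of_real u \<cdot>\<^sub>m id_tensor n d \<Phi> A + complex_of_real v \<cdot>\<^sub>m id_tensor n d \<Psi> A"
proof -
  have "dim_row (\<Phi> (mat_block d A i j)) = d" "dim_col (\<Phi> (mat_block d A i j)) = d"
    "dim_row (\<Psi> (mat_block d A i j)) = d" "dim_col (\<Psi> (mat_block d A i j)) = d" for i j
    using linear_mapsD(1)[OF assms(1) mat_block_carrier[of d A i j]]
      linear_mapsD(1)[OF assms(2) mat_block_carrier[of d A i j]] by auto
  then show ?thesis
    by (intro eq_matI) (auto simp: id_tensor_def mix_map_def mod_less_block)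
qed

text \<open>For fixed x the form (A x, x) is linear in A, and nonnegative reals are closed under
  sums with nonnegative coefficients.\<close>

lemma pos_semidef_combination:
  assumes "pos_semidef n A" "pos_semidef n B" "0 \<le> u" "0 \<le> v"
  shows "pos_semidef n (complex_of_real u \<cdot>\<^sub>m A + complex_of_real v \<cdot>\<^sub>m B)"
proof -
  have A: "A \<in> carrier_mat n n" and B: "B \<in> carrier_mat n n"
    using assms by (auto simp: pos_semidef_def)
  have "0 \<le> ((complex_of_real u \<cdot>\<^sub>m A + complex_of_real v \<cdot>\<^sub>m B) *\<^sub>v x) \<bullet>c x"
    if x: "x \<in> carrier_vec n" for x
  proof -
    have Ax: "A *\<^sub>v x \<in> carrier_vec n" and Bx: "B *\<^sub>v x \<in> carrier_vec n"
      using A B x by auto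
    have "(complex_of_real u \<cdot>\<^sub>m A + complex_of_real v \<cdot>\<^sub>m B) *\<^sub>v x =
        complex_of_real u \<cdot>\<^sub>v (A *\<^sub>v x) + complex_of_real v \<cdot>\<^sub>v (B *\<^sub>v x)"
      using A B x by (intro eq_vecI) (auto simp: add_scalar_prod_distrib[of _ n])
    moreover have "\<dots> \<bullet>c x = complex_of_real u * ((A *\<^sub>v x) \<bullet>c x) + complex_of_real v * ((B *\<^sub>v x) \<bullet>c x)"
      using Ax Bx x by (simp add: add_scalar_prod_distrib[of _ n])
    moreover have "0 \<le> (A *\<^sub>v x) \<bullet>c x" "0 \<le> (B *\<^sub>v x) \<bullet>c x"
      using assms x by (auto simp: pos_semidef_def)
    ultimately show ?thesis
      using assms(3,4) by (simp add: less_eq_complex_def)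
  qed
  then show ?thesis using A B by (simp add: pos_semidef_def)
qed

lemma mat_trace_combination:
  assumes "A \<in> carrier_mat n n" "B \<in> carrier_mat n n"
  shows "mat_trace (a \<cdot>\<^sub>m A + b \<cdot>\<^sub>m B) = a * mat_trace A + b * mat_trace B"
  using assms by (simp add: mat_trace_def sum.distrib sum_distrib_left)

lemma CPT_mix_map:
  assumes "\<Phi> \<in> CPT d" "\<Psi> \<in> CPT d" "0 \<le> u" "0 \<le> v" "u + v = 1"
  shows "mix_map d u v \<Phi> \<Psi> \<in> CPT d"
proof -
  have lin: "\<Phi> \<in> linear_maps d" "\<Psi> \<in> linear_maps d"
    using assms by (auto simp: CPT_def)
  have "completely_positive d (mix_map d u v \<Phi> \<Psi>)"
    using assms
    by (auto simp: completely_positive_def CPT_def id_tensor_mix_map intro: pos_semidef_combination)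
  moreover have "trace_preserving d (mix_map d u v \<Phi> \<Psi>)"
    unfolding trace_preserving_def
  proof
    fix X :: "complex mat" assume X: "X \<in> carrier_mat d d"
    have "mat_trace (mix_map d u v \<Phi> \<Psi> X) =
        complex_of_real u * mat_trace (\<Phi> X) + complex_of_real v * mat_trace (\<Psi> X)"
      using X lin by (simp add: mix_map_def mat_trace_combination[of _ d] linear_mapsD(1))
    \<comment> \<open>Both maps preserve the trace, so the two terms share the factor
      \<open>mat_trace X\<close>.\<close>
    also have "\<dots> = complex_of_real (u + v) * mat_trace X"
      using assms(1,2) X by (simp add: CPT_def trace_preserving_def algebra_simps)
    finally show "mat_trace (mix_map d u v \<Phi> \<Psi> X) = mat_trace X"
      using assms(5) by simp
  qed
  ultimately show ?thesis
    using mix_map_linear[OF lin] by (simp add: CPT_def)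
qed

text \<open>Addition in the module is entrywise, so induction on S turns the abstract sum in
  \<open>separable\<close> into ordinary complex sums, which can be split and rescaled. The carrier
  assumption is what \<open>finsum_insert\<close> requires of the summands.\<close>

lemma finsum_module_mat:
  assumes "finite S" "\<And>k. k \<in> S \<Longrightarrow> f k \<in> carrier_mat n m"
  shows "finsum (module_mat TYPE(complex) n m) f S = mat n m (\<lambda>(i, j). \<Sum>k\<in>S. f k $$ (i, j))"
proof -
  interpret abelian_monoid "module_mat TYPE(complex) n m"
    using abelian_group_mat abelian_group_def by blast
  show ?thesis
    using assms
  proof (induction S rule: finite_induct)
    case empty
    then show ?case by (auto simp: module_mat_simps)
  next
    case (insert k S)
    then have "f \<in> S \<rightarrow> carrier (module_mat TYPE(complex) n m)"
      "f k \<in> carrier (module_mat TYPE(complex) n m)"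
      by (auto simp: module_mat_simps)
    with insert show ?case
      by (intro eq_matI) (auto simp: finsum_insert module_mat_simps)
  qed
qed

lemma tensor_mat_carrier:
  "A \<in> carrier_mat n n \<Longrightarrow> B \<in> carrier_mat d d \<Longrightarrow> tensor_mat A B \<in> carrier_mat (n * d) (n * d)"
  by (auto simp: tensor_mat_def)

lemma sum_lessThan_append:
  fixes m l :: nat and g :: "nat \<Rightarrow> 'a::comm_monoid_add"
  shows "(\<Sum>k<m + l. g k) = (\<Sum>k<m. g k) + (\<Sum>k<l. g (m + k))"
  by (induction l) (simp_all add: add.assoc)

text \<open>The two product decompositions are concatenated, with weights scaled by \<open>u\<close> and \<open>v\<close>.\<close>

lemma separable_combination:
  assumes "separable n d A" "separable n d B" "0 \<le> u" "0 \<le> v" "u + v = 1"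
  shows "separable n d (complex_of_real u \<cdot>\<^sub>m A + complex_of_real v \<cdot>\<^sub>m B)"
proof -
  let ?M = "module_mat TYPE(complex) (n * d) (n * d)"
  obtain m :: nat and p \<rho> \<sigma> where
    D1: "\<forall>k<m. 0 \<le> p k \<and> density n (\<rho> k) \<and> density d (\<sigma> k)" "(\<Sum>k<m. p k) = 1" and
    A: "A = finsum ?M (\<lambda>k. complex_of_real (p k) \<cdot>\<^sub>m tensor_mat (\<rho> k) (\<sigma> k)) {..<m}"
    using assms(1) unfolding separable_def by blast
  obtain l :: nat and q \<rho>' \<sigma>' where
    D2: "\<forall>k<l. 0 \<le> q k \<and> density n (\<rho>' k) \<and> density d (\<sigma>' k)" "(\<Sum>k<l. q k) = 1" and
    B: "B = finsum ?M (\<lambda>k. complex_of_real (q k) \<cdot>\<^sub>m tensor_mat (\<rho>' k) (\<sigma>' k)) {..<l}"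
    using assms(2) unfolding separable_def by blast
  define r where "r k = (if k < m then u * p k else v * q (k - m))" for k
  define R where "R k = (if k < m then \<rho> k else \<rho>' (k - m))" for k
  define S where "S k = (if k < m then \<sigma> k else \<sigma>' (k - m))" for k
  have weights: "\<forall>k<m + l. 0 \<le> r k \<and> density n (R k) \<and> density d (S k)"
    using D1(1) D2(1) assms(3,4) by (auto simp: r_def R_def S_def)
  \<comment> \<open>Splitting at m and pulling out the scalars leaves u * 1 + v * 1.\<close>
  have total: "(\<Sum>k<m + l. r k) = 1"
    using D1(2) D2(2) assms(5)
    by (simp add: sum_lessThan_append r_def flip: sum_distrib_left)
  have T1: "tensor_mat (\<rho> k) (\<sigma> k) \<in> carrier_mat (n * d) (n * d)" if "k < m" for k
    using D1(1) that by (auto simp: density_def pos_semidef_def intro: tensor_mat_carrier)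
  have T2: "tensor_mat (\<rho>' k) (\<sigma>' k) \<in> carrier_mat (n * d) (n * d)" if "k < l" for k
    using D2(1) that by (auto simp: density_def pos_semidef_def intro: tensor_mat_carrier)
  have T: "tensor_mat (R k) (S k) \<in> carrier_mat (n * d) (n * d)" if "k < m + l" for k
    using weights that by (auto simp: density_def pos_semidef_def intro: tensor_mat_carrier)
  let ?N = "n * d"
  have A': "A = mat ?N ?N (\<lambda>(i, j). \<Sum>k<m. complex_of_real (p k) * tensor_mat (\<rho> k) (\<sigma> k) $$ (i, j))"
    unfolding A by (subst finsum_module_mat) (auto simp: T1 dest: T1 intro!: cong_mat sum.cong)
  have B': "B = mat ?N ?N (\<lambda>(i, j). \<Sum>k<l. complex_of_real (q k) * tensor_mat (\<rho>' k) (\<sigma>' k) $$ (i, j))"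
    unfolding B by (subst finsum_module_mat) (auto simp: T2 dest: T2 intro!: cong_mat sum.cong)
  have F: "finsum ?M (\<lambda>k. complex_of_real (r k) \<cdot>\<^sub>m tensor_mat (R k) (S k)) {..<m + l} =
      mat ?N ?N (\<lambda>(i, j). \<Sum>k<m + l. complex_of_real (r k) * tensor_mat (R k) (S k) $$ (i, j))"
    by (subst finsum_module_mat) (auto simp: T dest: T intro!: cong_mat sum.cong)
  \<comment> \<open>Compared entrywise: the sum up to \<open>m + l\<close> splits at m, and in the
    second part the index \<open>m + k\<close> is shifted back to k, which recovers the
    decomposition of B.\<close>
  have "complex_of_real u \<cdot>\<^sub>m A + complex_of_real v \<cdot>\<^sub>m B =
      finsum ?M (\<lambda>k. complex_of_real (r k) \<cdot>\<^sub>m tensor_mat (R k) (S k)) {..<m + l}"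
    unfolding F A' B'
    by (intro eq_matI)
      (auto simp: sum_lessThan_append sum_distrib_left r_def R_def S_def mult.assoc)
  with weights total show ?thesis
    unfolding separable_def
    by (intro exI[of _ "m + l"] exI[of _ r] exI[of _ R] exI[of _ S] conjI)
qed

theorem theorem3:
  fixes d :: nat
  assumes "d \<ge> 1"
  shows "convex_maps d (EBT d)"
proof -
  have "mix_map d u v \<Phi> \<Psi> \<in> EBT d"
    if "\<Phi> \<in> EBT d" "\<Psi> \<in> EBT d" "0 \<le> u" "0 \<le> v" "u + v = 1" for \<Phi> \<Psi> u v
  proof -
    \<comment> \<open>Linearity is extracted separately because it is the premise for rewriting with
      \<open>id_tensor_mix_map\<close>.\<close>
    have "\<Phi> \<in> linear_maps d" "\<Psi> \<in> linear_maps d"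
      using that by (auto simp: EBT_def CPT_def)
    with that show ?thesis
      by (auto simp: EBT_def id_tensor_mix_map intro: CPT_mix_map separable_combination)
  qed
  then show ?thesis
    by (simp add: convex_maps_def mix_map_def)
qed

end
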